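(* Let $q$ be an odd prime power, $n\ge 1$, $k=\mathbb{F}_q$, $K=\mathbb{F}_{q^2}$, and let $A_n=M_n(K)$ be equipped with the involution $(a^* )_{ij}=\overline{a_{ji}}$. Then the quasi-split unitary group $U(n,n)(K/k)$ is isomorphic (as a group) to $SL_*^{-1}(2,A_n)$.
   Context: Here $\lambda\mapsto\overline{\lambda}$ is the nontrivial $k$-automorphism of $K$. For a row vector $y=(y_1,\dots,y_l)\in K^l$, $y^*=(\overline{y_1},\dots,\overline{y_l})^{t}$ (a column vector). The group $U(n,n)(K/k)$ is the group of $K$-linear isometries of the hermitian form $h$ on the space of row vectors $K^{2n}$ given by $h(x,y)=xJ_+y^*$, where $J_+=\begin{pmatrix}0&I_n\\ I_n&0\end{pmatrix}$. The group $SL_*^{-1}(2,A_n)$ is the group, under matrix multiplication, of all matrices $g=\begin{pmatrix}a&b\\c&d\end{pmatrix}$ with entries $a,b,c,d\in A_n$ satisfying $a^*c=c^*a$, $ab^*=ba^*$, $b^*d=d^*b$, $cd^*=dc^*$, and $ad^*-bc^*=a^*d-c^*b=1$. *)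

theory Defs
  imports
    "HOL-Algebra.Bij"
    "HOL-Algebra.Subrings"
    "HOL-Algebra.QuotRing"
    "HOL-Number_Theory.Prime_Powers"
    "Jordan_Normal_Form.VS_Connect"
begin

text \<open>Throughout, \<open>\<sigma>\<close> plays the role of the conjugation of the field extension
  \<open>K/k\<close>, where \<open>K\<close> is the field type \<open>'a\<close>.\<close>

definition nontrivial_automorphism_over :: "'a::field set \<Rightarrow> ('a \<Rightarrow> 'a) \<Rightarrow> bool" where
  "nontrivial_automorphism_over k \<sigma> \<longleftrightarrow>
     \<sigma> \<in> ring_iso class_ring class_ring \<and> (\<forall>x\<in>k. \<sigma> x = x) \<and> \<sigma> \<noteq> id"

definition mat_star :: "('a \<Rightarrow> 'a) \<Rightarrow> 'a mat \<Rightarrow> 'a mat" where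
  "mat_star \<sigma> a = map_mat \<sigma> (transpose_mat a)"

definition J_plus :: "nat \<Rightarrow> 'a::field mat" where
  "J_plus n = four_block_mat (0\<^sub>m n n) (1\<^sub>m n) (1\<^sub>m n) (0\<^sub>m n n)"

text \<open>The form \<open>h(x,y) = x J y\<^sup>*\<close>; the product of the row vector \<open>x\<close> with the
  column vector \<open>J y\<^sup>*\<close> is a scalar product.\<close>

definition herm_form :: "('a::field \<Rightarrow> 'a) \<Rightarrow> nat \<Rightarrow> 'a vec \<Rightarrow> 'a vec \<Rightarrow> 'a" where
  "herm_form \<sigma> n x y = x \<bullet> (J_plus n *\<^sub>v map_vec \<sigma> y)"

text \<open>The \<open>K\<close>-linear isometries of \<open>K\<^sup>2\<^sup>n\<close> under composition. As in
  \<^const>\<open>BijGroup\<close>, maps are extensional, that is, \<open>undefined\<close> outside \<open>K\<^sup>2\<^sup>n\<close>.\<close>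

definition unitary_group :: "('a::field \<Rightarrow> 'a) \<Rightarrow> nat \<Rightarrow> ('a vec \<Rightarrow> 'a vec) monoid" where
  "unitary_group \<sigma> n = BijGroup (carrier_vec (2 * n))
     \<lparr>carrier := {f \<in> Bij (carrier_vec (2 * n)).
        f \<in> module_hom class_ring (module_vec TYPE('a) (2 * n)) (module_vec TYPE('a) (2 * n)) \<and>
        (\<forall>x\<in>carrier_vec (2 * n). \<forall>y\<in>carrier_vec (2 * n).
            herm_form \<sigma> n (f x) (f y) = herm_form \<sigma> n x y)}\<rparr>"

text \<open>The group \<open>SL\<^sub>*\<^sup>-\<^sup>1(2,A)\<close> of a ring \<open>A\<close> with involution \<open>star\<close>. The
  2 by 2 matrix with rows \<open>(a, b)\<close> and \<open>(c, d)\<close> over \<open>A\<close> is the tuple \<open>(a, b, c, d)\<close>.\<close>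

definition SL_star_minus ::
  "('r, 'm) ring_scheme \<Rightarrow> ('r \<Rightarrow> 'r) \<Rightarrow> ('r \<times> 'r \<times> 'r \<times> 'r) monoid" where
  "SL_star_minus A star =
     \<lparr>carrier = {(a, b, c, d).
        a \<in> carrier A \<and> b \<in> carrier A \<and> c \<in> carrier A \<and> d \<in> carrier A \<and>
        star a \<otimes>\<^bsub>A\<^esub> c = star c \<otimes>\<^bsub>A\<^esub> a \<and>
        a \<otimes>\<^bsub>A\<^esub> star b = b \<otimes>\<^bsub>A\<^esub> star a \<and>
        star b \<otimes>\<^bsub>A\<^esub> d = star d \<otimes>\<^bsub>A\<^esub> b \<and>
        c \<otimes>\<^bsub>A\<^esub> star d = d \<otimes>\<^bsub>A\<^esub> star c \<and>
        a \<otimes>\<^bsub>A\<^esub> star d \<ominus>\<^bsub>A\<^esub> b \<otimes>\<^bsub>A\<^esub> star c = \<one>\<^bsub>A\<^esub> \<and>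
        star a \<otimes>\<^bsub>A\<^esub> d \<ominus>\<^bsub>A\<^esub> star c \<otimes>\<^bsub>A\<^esub> b = \<one>\<^bsub>A\<^esub>},
      monoid.mult = (\<lambda>(a, b, c, d) (a', b', c', d').
        (a \<otimes>\<^bsub>A\<^esub> a' \<oplus>\<^bsub>A\<^esub> b \<otimes>\<^bsub>A\<^esub> c', a \<otimes>\<^bsub>A\<^esub> b' \<oplus>\<^bsub>A\<^esub> b \<otimes>\<^bsub>A\<^esub> d',
         c \<otimes>\<^bsub>A\<^esub> a' \<oplus>\<^bsub>A\<^esub> d \<otimes>\<^bsub>A\<^esub> c', c \<otimes>\<^bsub>A\<^esub> b' \<oplus>\<^bsub>A\<^esub> d \<otimes>\<^bsub>A\<^esub> d')),
      monoid.one = (\<one>\<^bsub>A\<^esub>, \<zero>\<^bsub>A\<^esub>, \<zero>\<^bsub>A\<^esub>, \<one>\<^bsub>A\<^esub>)\<rparr>"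

lemma group_unitary_group: "group (unitary_group \<sigma> n)"
proof -
  let ?V = "carrier_vec (2 * n) :: 'a vec set"
  let ?M = "module_vec TYPE('a) (2 * n)"
  let ?U = "carrier (unitary_group \<sigma> n)"
  interpret B: group "BijGroup ?V" by (rule group_BijGroup)
  have cB: "carrier (BijGroup ?V) = Bij ?V"
    and mB: "\<And>f g. f \<in> Bij ?V \<Longrightarrow> g \<in> Bij ?V \<Longrightarrow> f \<otimes>\<^bsub>BijGroup ?V\<^esub> g = compose ?V f g"
    and oB: "\<one>\<^bsub>BijGroup ?V\<^esub> = (\<lambda>x\<in>?V. x)"
    by (auto simp: BijGroup_def)
  have U: "f \<in> ?U \<longleftrightarrow> f \<in> Bij ?V \<and>
      (\<forall>x\<in>?V. \<forall>y\<in>?V. f (x + y) = f x + f y) \<and> (\<forall>c. \<forall>x\<in>?V. f (c \<cdot>\<^sub>v x) = c \<cdot>\<^sub>v f x) \<and>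
      (\<forall>x\<in>?V. \<forall>y\<in>?V. herm_form \<sigma> n (f x) (f y) = herm_form \<sigma> n x y)" for f
    using Bij_imp_funcset[of f ?V]
    by (auto simp: unitary_group_def module_hom_def module_vec_simps)
  have "subgroup ?U (BijGroup ?V)"
  proof (rule B.subgroupI)
    show "?U \<subseteq> carrier (BijGroup ?V)" using U cB by blast
    have "(\<lambda>x\<in>?V. x) \<in> ?U" unfolding U by (auto simp: id_Bij)
    then show "?U \<noteq> {}" by blast
  next
    fix f assume f: "f \<in> ?U"
    define g where "g = inv\<^bsub>BijGroup ?V\<^esub> f"
    have fB: "f \<in> Bij ?V" using f U by blast
    then have gB: "g \<in> Bij ?V" using B.inv_closed[of f] cB g_def by auto
    have "compose ?V f g = (\<lambda>x\<in>?V. x)"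
      using B.r_inv[of f] fB gB cB mB[OF fB gB] oB by (simp add: g_def)
    then have fg: "f (g x) = x" if "x \<in> ?V" for x
      using that by (metis compose_eq restrict_apply')
    have gV: "g x \<in> ?V" if "x \<in> ?V" for x
      using Bij_imp_funcset[OF gB] that by blast
    have inj: "u = v" if "f u = f v" "u \<in> ?V" "v \<in> ?V" for u v
      using that fB by (auto simp: Bij_def bij_betw_def inj_on_def)
    have add: "g (x + y) = g x + g y" if "x \<in> ?V" "y \<in> ?V" for x y
    proof (rule inj)
      have "f (g x + g y) = f (g x) + f (g y)" using f U gV that by blast
      then show "f (g (x + y)) = f (g x + g y)" using that fg by simp
    qed (use that gV in auto)
    have smult: "g (c \<cdot>\<^sub>v x) = c \<cdot>\<^sub>v g x" if "x \<in> ?V" for c x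
    proof (rule inj)
      have "f (c \<cdot>\<^sub>v g x) = c \<cdot>\<^sub>v f (g x)" using f U gV that by blast
      then show "f (g (c \<cdot>\<^sub>v x)) = f (c \<cdot>\<^sub>v g x)" using that fg by simp
    qed (use that gV in auto)
    have herm: "herm_form \<sigma> n (g x) (g y) = herm_form \<sigma> n x y" if "x \<in> ?V" "y \<in> ?V" for x y
    proof -
      have "herm_form \<sigma> n (f (g x)) (f (g y)) = herm_form \<sigma> n (g x) (g y)"
        using f U gV that by blast
      then show ?thesis using that fg by simp
    qed
    have "g \<in> ?U" unfolding U using gB add smult herm by blast
    then show "inv\<^bsub>BijGroup ?V\<^esub> f \<in> ?U" by (simp add: g_def)
  next
    fix f g assume f: "f \<in> ?U" and g: "g \<in> ?U"
    then have fB: "f \<in> Bij ?V" and gB: "g \<in> Bij ?V" using U by blast+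
    have gV: "g x \<in> ?V" if "x \<in> ?V" for x
      using Bij_imp_funcset[OF gB] that by blast
    have "compose ?V f g \<in> ?U"
      unfolding U using f[unfolded U] g[unfolded U] gV
      by (simp add: compose_Bij compose_eq)
    then show "f \<otimes>\<^bsub>BijGroup ?V\<^esub> g \<in> ?U" by (simp add: mB[OF fB gB])
  qed
  then have "group (BijGroup ?V\<lparr>carrier := ?U\<rparr>)"
    by (rule B.subgroup_imp_group)
  then show ?thesis by (simp add: unitary_group_def)
qed

end

theory Submission
  imports Defs
begin

text \<open>Write a linear map of \<open>K\<^sup>2\<^sup>n\<close> as \<open>x \<mapsto> A x\<close> and let \<open>J\<close> be \<^const>\<open>J_plus\<close>. Since
  \<open>h(x,y) = x\<^sup>t J \<sigma>(y)\<close>, the map is an isometry iff \<open>A\<^sup>t J \<sigma>(A) = J\<close>; conjugating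
  every entry turns this into \<open>A\<^sup>* J A = J\<close> (lemma \<open>isometry_iff_mat\<close>). Because
  \<open>J\<^sup>2 = 1\<close>, such an \<open>A\<close> is invertible with inverse \<open>J A\<^sup>* J\<close>, and so it also satisfies
  \<open>A J A\<^sup>* = J\<close> (lemma \<open>gram_inverse\<close>).

  The equations that define the other group say, for a block matrix \<open>g\<close>, that
  \<open>g\<^sup>* J' g = J'\<close> and \<open>g J' g\<^sup>* = J'\<close>, where \<open>J'\<close> is the skew-hermitian matrix with block rows
  \<open>(0, 1)\<close> and \<open>(-1, 0)\<close>. A hermitian form becomes skew-hermitian when it is multiplied by a
  scalar \<open>\<epsilon>\<close> with \<open>\<sigma>(\<epsilon>) = -\<epsilon>\<close>. Concretely, with \<open>T = diag(1, \<epsilon>)\<close> one has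
  \<open>T J T\<^sup>* = -\<epsilon> J'\<close>, so \<open>g\<close> preserves \<open>J'\<close> iff \<open>A = T\<^sup>-\<^sup>1 g T\<close> preserves \<open>J\<close>. Conjugation by
  \<open>T\<close>, written out in blocks as \<open>twist\<close>, is therefore the isomorphism. Lemma
  \<open>mem_SL_iff_gram\<close> compares the defining equations, and every isometry arises because
  linear maps are given by matrices (lemma \<open>linear_map_eq_mult_mat_vec\<close>).

  What is needed about the fields is that \<open>\<sigma>\<close> is an involution and that \<open>\<epsilon>\<close> exists. Both follow
  from \<open>|K| = |k|\<^sup>2\<close>: for any \<open>x\<close> moved by \<open>\<sigma>\<close> one has \<open>K = k + k x\<close>, so \<open>x\<close> is a root of a
  monic quadratic over \<open>k\<close>, whose other root is \<open>\<sigma>(x)\<close> (lemma \<open>quadratic_conjugation\<close>).\<close>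

section \<open>The conjugation of a quadratic extension\<close>

text \<open>A counting substitute for the degree formula: \<open>1\<close> and \<open>x\<close> are linearly independent
  over \<open>k\<close>, so the \<open>|k|\<^sup>2\<close> combinations of them are distinct and exhaust the field.\<close>

lemma card_square_subfield_basis:
  fixes k :: "'a::field set" and x :: 'a
  assumes card: "card (UNIV :: 'a set) = (card k)\<^sup>2" and fin: "finite (UNIV :: 'a set)"
    and k: "subfield k (class_ring :: 'a ring)" and x: "x \<notin> k"
  shows "\<exists>a\<in>k. \<exists>b\<in>k. y = a + b * x"
proof -
  note closed = subringE[OF subfieldE(1)[OF k]]
  have diff: "a - b \<in> k" if "a \<in> k" "b \<in> k" for a b
    using that closed(7)[of a "- b"] closed(5)[of b] by (simp add: class_ring_simps)
  have inv: "inverse a \<in> k" if "a \<in> k" "a \<noteq> 0" for a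
    using ring.subfield_m_inv(1)[OF class_ring.ring_axioms k, of a] that by (simp add: class_ring_simps)
  have mult: "a * b \<in> k" if "a \<in> k" "b \<in> k" for a b
    using that closed(6)[of a b] by simp
  let ?g = "\<lambda>(a, b). a + b * x"
  have "inj_on ?g (k \<times> k)"
  proof (rule inj_onI, clarify)
    fix a b c d assume mem: "a \<in> k" "b \<in> k" "c \<in> k" "d \<in> k" and eq: "a + b * x = c + d * x"
    have "b = d"
    proof (rule ccontr)
      assume "b \<noteq> d"
      then have "x = (a - c) * inverse (d - b)"
        using eq by (simp add: field_simps)
      moreover have "(a - c) * inverse (d - b) \<in> k"
        using mem \<open>b \<noteq> d\<close> by (intro mult diff inv) auto
      ultimately show False using x by simp
    qed
    then show "a = c \<and> b = d" using eq by simp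
  qed
  then have "card (?g ` (k \<times> k)) = card (UNIV :: 'a set)"
    by (simp add: card_image card card_cartesian_product power2_eq_square)
  then have "?g ` (k \<times> k) = UNIV"
    using fin by (intro card_subset_eq) auto
  then have "y \<in> ?g ` (k \<times> k)" by simp
  then show ?thesis by auto
qed

lemma nontrivial_automorphism_field_hom:
  assumes "nontrivial_automorphism_over k \<sigma>"
  shows "field_hom \<sigma>"
proof -
  have h: "\<sigma> \<in> Ring.ring_hom class_ring class_ring"
    using assms by (auto simp: nontrivial_automorphism_over_def ring_iso_def)
  have add: "\<sigma> (x + y) = \<sigma> x + \<sigma> y" and mult: "\<sigma> (x * y) = \<sigma> x * \<sigma> y" and one: "\<sigma> 1 = 1" for x y
    using ring_hom_add[OF h] ring_hom_mult[OF h] ring_hom_one[OF h] by simp_all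
  moreover have "\<sigma> 0 = 0" using add[of 0 0] by (metis add_0_right add_cancel_right_right)
  ultimately show ?thesis by unfold_locales
qed

text \<open>For \<open>x\<close> with \<open>\<sigma>(x) \<noteq> x\<close> write \<open>x\<^sup>2 = a + b x\<close> over \<open>k\<close>. Then \<open>\<sigma>(x)\<close> is the other root
  \<open>b - x\<close> of this quadratic, so \<open>\<sigma>\<close> exchanges the two roots, and their difference
  \<open>\<sigma>(x) - x\<close> is a suitable \<open>\<epsilon>\<close>.\<close>

lemma quadratic_conjugation:
  fixes k :: "'a::field set"
  assumes card: "card (UNIV :: 'a set) = (card k)\<^sup>2" and fin: "finite (UNIV :: 'a set)"
    and k: "subfield k (class_ring :: 'a ring)" and \<sigma>: "nontrivial_automorphism_over k \<sigma>"
  shows "\<sigma> (\<sigma> y) = y" and "\<exists>\<epsilon>. \<epsilon> \<noteq> 0 \<and> \<sigma> \<epsilon> = - \<epsilon>"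
proof -
  interpret field_hom \<sigma> using \<sigma> by (rule nontrivial_automorphism_field_hom)
  have fix_k: "\<sigma> a = a" if "a \<in> k" for a
    using that \<sigma> by (simp add: nontrivial_automorphism_over_def)
  obtain x where x: "\<sigma> x \<noteq> x"
    using \<sigma> by (auto simp: nontrivial_automorphism_over_def fun_eq_iff)
  then have "x \<notin> k" using fix_k by blast
  note basis = card_square_subfield_basis[OF card fin k this]
  obtain a b where ab: "a \<in> k" "b \<in> k" "x * x = a + b * x"
    using basis[of "x * x"] by blast
  \<comment> \<open>Both \<open>x\<close> and \<open>\<sigma> x\<close> satisfy the quadratic; subtract and cancel \<open>\<sigma> x - x\<close>.\<close>
  have "\<sigma> x * \<sigma> x = a + b * \<sigma> x"
    using arg_cong[OF ab(3), of \<sigma>] fix_k ab(1,2) by (simp add: hom_add hom_mult)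
  then have "(\<sigma> x - x) * (\<sigma> x + x - b) = 0"
    using ab(3) by (simp add: algebra_simps)
  then have "\<sigma> x + x - b = 0" using x by auto
  then have sx: "\<sigma> x = b - x" by (simp add: algebra_simps)
  then have ssx: "\<sigma> (\<sigma> x) = x"
    using fix_k ab(2) by (simp add: hom_minus)
  obtain c d where "c \<in> k" "d \<in> k" "y = c + d * x"
    using basis[of y] by blast
  then show "\<sigma> (\<sigma> y) = y"
    using fix_k ssx by (simp add: hom_add hom_mult)
  have "\<sigma> (\<sigma> x - x) = - (\<sigma> x - x)"
    using ssx by (simp add: hom_minus)
  then show "\<exists>\<epsilon>. \<epsilon> \<noteq> 0 \<and> \<sigma> \<epsilon> = - \<epsilon>"
    using x by (intro exI[of _ "\<sigma> x - x"]) simp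
qed

section \<open>Matrices of linear maps and block matrices\<close>

lemma linear_map_eq_mult_mat_vec:
  fixes f :: "'a::field vec \<Rightarrow> 'a vec"
  assumes f: "f \<in> module_hom class_ring (module_vec TYPE('a) m) (module_vec TYPE('a) m)"
  obtains A where "A \<in> carrier_mat m m" "\<And>x. x \<in> carrier_vec m \<Longrightarrow> f x = A *\<^sub>v x"
proof
  have fV: "f x \<in> carrier_vec m" and add: "y \<in> carrier_vec m \<Longrightarrow> f (x + y) = f x + f y"
    and smult: "f (c \<cdot>\<^sub>v x) = c \<cdot>\<^sub>v f x" if "x \<in> carrier_vec m" for x y c
    using f that by (auto simp: module_hom_def module_vec_simps)
  let ?A = "mat m m (\<lambda>(i, j). f (unit_vec m j) $ i)"
  show "?A \<in> carrier_mat m m" by simp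
  fix x :: "'a vec" assume x: "x \<in> carrier_vec m"
  \<comment> \<open>Expand \<open>f x\<close> along the truncations of \<open>x\<close> to its first \<open>l\<close> coordinates.\<close>
  let ?t = "\<lambda>l. vec m (\<lambda>i. if i < l then x $ i else 0)"
  have "f (?t l) = vec m (\<lambda>i. \<Sum>j<l. f (unit_vec m j) $ i * x $ j)" if "l \<le> m" for l
    using that
  proof (induction l)
    case 0
    \<comment> \<open>The zero vector is mapped to zero, by homogeneity with the scalar \<open>0\<close>.\<close>
    have "f (0 \<cdot>\<^sub>v 0\<^sub>v m) = 0 \<cdot>\<^sub>v f (0\<^sub>v m)" by (rule smult) simp
    moreover have "0 \<cdot>\<^sub>v f (0\<^sub>v m) = 0\<^sub>v m" using fV[of "0\<^sub>v m"] by auto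
    moreover have "?t 0 = 0 \<cdot>\<^sub>v 0\<^sub>v m" by auto
    ultimately show ?case by auto
  next
    case (Suc l)
    have "?t (Suc l) = ?t l + x $ l \<cdot>\<^sub>v unit_vec m l"
      using Suc.prems by (intro eq_vecI) (auto simp: less_Suc_eq)
    then have "f (?t (Suc l)) = f (?t l) + x $ l \<cdot>\<^sub>v f (unit_vec m l)"
      by (simp add: add smult)
    then show ?case
      using Suc fV[of "unit_vec m l"] by (intro eq_vecI) (auto simp: algebra_simps)
  qed
  from this[of m] have "f (?t m) = vec m (\<lambda>i. \<Sum>j<m. f (unit_vec m j) $ i * x $ j)"
    by simp
  moreover have "?t m = x" using x by (intro eq_vecI) auto
  ultimately show "f x = ?A *\<^sub>v x"
    using x by (intro eq_vecI) (auto simp: scalar_prod_def atLeast0LessThan)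
qed

lemma mat_eq_by_bilinear_values:
  fixes A B :: "'a::comm_ring_1 mat"
  assumes A: "A \<in> carrier_mat m m" and B: "B \<in> carrier_mat m m"
    and eq: "\<And>i j. i < m \<Longrightarrow> j < m \<Longrightarrow>
      unit_vec m i \<bullet> (A *\<^sub>v unit_vec m j) = unit_vec m i \<bullet> (B *\<^sub>v unit_vec m j)"
  shows "A = B"
proof (rule eq_matI)
  fix i j assume "i < dim_row B" "j < dim_col B"
  then show "A $$ (i, j) = B $$ (i, j)" using eq[of i j] A B by simp
qed (use A B in auto)

lemma mat_eq_by_action:
  fixes A B :: "'a::comm_ring_1 mat"
  assumes A: "A \<in> carrier_mat m m" and B: "B \<in> carrier_mat m m"
    and eq: "\<And>x. x \<in> carrier_vec m \<Longrightarrow> A *\<^sub>v x = B *\<^sub>v x"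
  shows "A = B"
  by (rule mat_eq_by_bilinear_values[OF A B]) (simp add: eq)

lemma four_block_mat_inject:
  assumes "A \<in> carrier_mat n n" "B \<in> carrier_mat n n" "C \<in> carrier_mat n n" "D \<in> carrier_mat n n"
    and "A' \<in> carrier_mat n n" "B' \<in> carrier_mat n n" "C' \<in> carrier_mat n n" "D' \<in> carrier_mat n n"
  shows "four_block_mat A B C D = four_block_mat A' B' C' D' \<longleftrightarrow>
    A = A' \<and> B = B' \<and> C = C' \<and> D = D'"
proof
  assume eq: "four_block_mat A B C D = four_block_mat A' B' C' D'"
  have e: "four_block_mat A B C D $$ (i, j) = four_block_mat A' B' C' D' $$ (i, j)" for i j
    by (simp only: eq)
  have "A $$ (i, j) = A' $$ (i, j)" "B $$ (i, j) = B' $$ (i, j)"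
    "C $$ (i, j) = C' $$ (i, j)" "D $$ (i, j) = D' $$ (i, j)" if "i < n" "j < n" for i j
    using that assms e[of i j] e[of i "j + n"] e[of "i + n" j] e[of "i + n" "j + n"] by auto
  then show "A = A' \<and> B = B' \<and> C = C' \<and> D = D'"
    using assms by (intro conjI eq_matI) auto
qed simp

lemma smult_inverse_smult:
  fixes x :: "'a::field mat"
  assumes "t \<noteq> 0"
  shows "inverse t \<cdot>\<^sub>m (t \<cdot>\<^sub>m x) = x" and "t \<cdot>\<^sub>m (inverse t \<cdot>\<^sub>m x) = x"
  using assms by (simp_all add: mat_eq_iff field_simps)

lemma J_plus_carrier [simp]: "J_plus n \<in> carrier_mat (2 * n) (2 * n)"
  using four_block_carrier_mat[of "0\<^sub>m n n" n n "0\<^sub>m n n" n n] by (simp add: J_plus_def mult_2)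

lemma J_plus_square: "J_plus n * J_plus n = (1\<^sub>m (2 * n) :: 'a::field mat)"
  unfolding J_plus_def mult_2
  by (subst mult_four_block_mat[of _ n n _ n _ n _ _ n _ n]) auto

lemma mat_star_carrier [simp]: "A \<in> carrier_mat n m \<Longrightarrow> mat_star \<sigma> A \<in> carrier_mat m n"
  by (simp add: mat_star_def)

section \<open>Isometries as matrices\<close>

text \<open>The two facts about \<open>K/k\<close> that carry the rest of the argument: \<open>\<sigma>\<close> is an involution and
  some nonzero scalar \<open>\<epsilon>\<close> is skew.\<close>

locale skew_conjugation = field_hom \<sigma> for \<sigma> :: "'a::field \<Rightarrow> 'a" +
  fixes \<epsilon> :: 'a
  assumes conj_conj [simp]: "\<sigma> (\<sigma> x) = x"
    and skew_nonzero [simp]: "\<epsilon> \<noteq> 0"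
    and conj_skew [simp]: "\<sigma> \<epsilon> = - \<epsilon>"
begin

abbreviation star :: "'a mat \<Rightarrow> 'a mat" where
  "star \<equiv> mat_star \<sigma>"

lemma star_mult:
  assumes "A \<in> carrier_mat n m" "B \<in> carrier_mat m l"
  shows "star (A * B) = star B * star A"
  using assms by (simp add: mat_star_def transpose_mult mat_hom_mult[of _ l m _ n])

lemma star_star [simp]: "star (star A) = A"
  by (rule eq_matI) (auto simp: mat_star_def)

lemma star_smult: "star (c \<cdot>\<^sub>m A) = \<sigma> c \<cdot>\<^sub>m star A"
  by (rule eq_matI) (auto simp: mat_star_def hom_mult)

lemma star_one [simp]: "star (1\<^sub>m n) = 1\<^sub>m n"
  by (rule eq_matI) (auto simp: mat_star_def)

lemma star_minus:
  assumes "A \<in> carrier_mat n m" "B \<in> carrier_mat n m"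
  shows "star (A - B) = star A - star B"
  using assms by (intro eq_matI) (auto simp: mat_star_def hom_minus)

lemma star_four_block_mat:
  assumes "A \<in> carrier_mat n n" "B \<in> carrier_mat n n" "C \<in> carrier_mat n n" "D \<in> carrier_mat n n"
  shows "star (four_block_mat A B C D) = four_block_mat (star A) (star C) (star B) (star D)"
  using assms unfolding mat_star_def
  by (simp add: transpose_four_block_mat[of _ n n _ n _ n] map_four_block_mat[of _ n n _ n _ n])

lemma conj_J_plus [simp]: "map_mat \<sigma> (J_plus n) = J_plus n"
  by (rule eq_matI) (auto simp: J_plus_def)

text \<open>Pulling the form back along \<open>A\<close> gives the form with Gram matrix \<open>A\<^sup>t J \<sigma>(A)\<close>, and a
  form determines its Gram matrix by its values on unit vectors, which \<open>\<sigma>\<close> fixes. As \<open>J\<close> has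
  entries \<open>0\<close> and \<open>1\<close>, applying \<open>\<sigma>\<close> to \<open>A\<^sup>t J \<sigma>(A) = J\<close> gives the criterion below.\<close>

lemma isometry_iff_mat:
  assumes A: "A \<in> carrier_mat (2 * n) (2 * n)"
  shows "(\<forall>x\<in>carrier_vec (2 * n). \<forall>y\<in>carrier_vec (2 * n).
      herm_form \<sigma> n (A *\<^sub>v x) (A *\<^sub>v y) = herm_form \<sigma> n x y) \<longleftrightarrow>
    star A * J_plus n * A = J_plus n" (is "?iso \<longleftrightarrow> ?gram")
proof -
  let ?m = "2 * n" and ?J = "J_plus n :: 'a mat"
  let ?G = "transpose_mat A * (?J * map_mat \<sigma> A)"
  have sA: "map_mat \<sigma> A \<in> carrier_mat ?m ?m" using A by simp
  have G: "?G \<in> carrier_mat ?m ?m"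
    using A by (intro mult_carrier_mat[of _ _ ?m]) auto
  have form: "herm_form \<sigma> n (A *\<^sub>v x) (A *\<^sub>v y) = x \<bullet> (?G *\<^sub>v map_vec \<sigma> y)"
    if x: "x \<in> carrier_vec ?m" and y: "y \<in> carrier_vec ?m" for x y
  proof -
    let ?w = "?J *\<^sub>v (map_mat \<sigma> A *\<^sub>v map_vec \<sigma> y)"
    have w: "?w \<in> carrier_vec ?m"
      by (rule mult_mat_vec_carrier[OF J_plus_carrier]) (use sA y in auto)
    have "herm_form \<sigma> n (A *\<^sub>v x) (A *\<^sub>v y) = (A *\<^sub>v x) \<bullet> ?w"
      by (simp add: herm_form_def mult_mat_vec_hom[OF A y])
    also have "\<dots> = x \<bullet> (transpose_mat A *\<^sub>v ?w)"
      using transpose_vec_mult_scalar[of "transpose_mat A" ?m ?m ?w x] A x w by simp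
    also have "transpose_mat A *\<^sub>v ?w = ?G *\<^sub>v map_vec \<sigma> y"
      using A sA y
      by (simp add: assoc_mult_mat_vec[of _ ?m ?m _ ?m] mult_carrier_mat[of _ ?m ?m]
          mult_mat_vec_carrier[of _ ?m ?m])
    finally show ?thesis .
  qed
  have unit: "map_vec \<sigma> (unit_vec ?m j) = unit_vec ?m j" for j
    by (rule eq_vecI) (auto simp: unit_vec_def)
  have conjG: "map_mat \<sigma> ?G = star A * ?J * A"
  proof -
    have "map_mat \<sigma> ?G = star A * (?J * map_mat \<sigma> (map_mat \<sigma> A))"
      using A sA by (simp add: mat_star_def mat_hom_mult[of _ ?m ?m _ ?m]
          mult_carrier_mat[of _ ?m ?m])
    also have "map_mat \<sigma> (map_mat \<sigma> A) = A" by (rule eq_matI) auto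
    finally show ?thesis using A by (simp add: assoc_mult_mat[of _ ?m ?m _ ?m _ ?m])
  qed
  have "?G = ?J \<longleftrightarrow> map_mat \<sigma> ?G = map_mat \<sigma> ?J"
    by (metis (no_types, lifting) mat_hom_inj)
  also have "\<dots> \<longleftrightarrow> ?gram" by (simp only: conjG conj_J_plus)
  finally have gram: "?G = ?J \<longleftrightarrow> ?gram" .
  show ?thesis
  proof
    assume iso: ?iso
    have "?G = ?J"
    proof (rule mat_eq_by_bilinear_values[OF G J_plus_carrier])
      fix i j
      show "unit_vec ?m i \<bullet> (?G *\<^sub>v unit_vec ?m j) = unit_vec ?m i \<bullet> (?J *\<^sub>v unit_vec ?m j)"
        using iso form[of "unit_vec ?m i" "unit_vec ?m j"]
        by (simp add: unit herm_form_def)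
    qed
    then show ?gram using gram by simp
  next
    assume ?gram
    then have "?G = ?J" using gram by simp
    then show ?iso using form by (simp add: herm_form_def)
  qed
qed

text \<open>Over a field a one-sided inverse of a square matrix is two-sided, which turns
  \<open>A\<^sup>* J A = J\<close> into its mirror image. This is why preserving the form yields all six equations
  of the matrix group and not only three of them.\<close>

lemma gram_inverse:
  assumes A: "A \<in> carrier_mat (2 * n) (2 * n)" and gram: "star A * J_plus n * A = J_plus n"
  shows "J_plus n * star A * J_plus n * A = 1\<^sub>m (2 * n)"
    and "A * (J_plus n * star A * J_plus n) = 1\<^sub>m (2 * n)"
    and "A * J_plus n * star A = J_plus n"
proof -
  let ?m = "2 * n" and ?J = "J_plus n :: 'a mat"
  let ?B = "?J * star A * ?J"
  have J: "?J \<in> carrier_mat ?m ?m" and S: "star A \<in> carrier_mat ?m ?m" using A by auto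
  then have B: "?B \<in> carrier_mat ?m ?m" by (intro mult_carrier_mat[of _ ?m ?m])
  note assoc = assoc_mult_mat[of _ ?m ?m _ ?m _ ?m] mult_carrier_mat[of _ ?m ?m _ ?m]
  have "?B * A = ?J * (star A * ?J * A)" using A J S by (simp add: assoc)
  then show BA: "?B * A = 1\<^sub>m ?m" by (simp add: gram J_plus_square)
  show AB: "A * ?B = 1\<^sub>m ?m"
    by (rule mat_mult_left_right_inverse[OF B A BA])
  have "A * ?J * star A = A * ?B * ?J"
    using A J S by (simp add: assoc J_plus_square right_mult_one_mat[OF S])
  also have "\<dots> = ?J" by (simp only: AB left_mult_one_mat[OF J])
  finally show "A * ?J * star A = ?J" .
qed

section \<open>From the hermitian to the skew-hermitian form\<close>

text \<open>This is \<open>T\<^sup>-\<^sup>1 g T\<close> for the block matrix \<open>g\<close> with rows \<open>(a, b)\<close> and \<open>(c, d)\<close> and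
  \<open>T = diag(1, \<epsilon>)\<close>.\<close>

fun twist :: "'a mat \<times> 'a mat \<times> 'a mat \<times> 'a mat \<Rightarrow> 'a mat" where
  "twist (a, b, c, d) = four_block_mat a (\<epsilon> \<cdot>\<^sub>m b) (inverse \<epsilon> \<cdot>\<^sub>m c) d"

lemma twist_carrier:
  assumes "a \<in> carrier_mat n n" "d \<in> carrier_mat n n"
  shows "twist (a, b, c, d) \<in> carrier_mat (2 * n) (2 * n)"
  using four_block_carrier_mat[OF assms] by (simp add: mult_2)

lemma twist_inject:
  assumes "a \<in> carrier_mat n n" "b \<in> carrier_mat n n" "c \<in> carrier_mat n n" "d \<in> carrier_mat n n"
    and "a' \<in> carrier_mat n n" "b' \<in> carrier_mat n n" "c' \<in> carrier_mat n n" "d' \<in> carrier_mat n n"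
    and eq: "twist (a, b, c, d) = twist (a', b', c', d')"
  shows "(a, b, c, d) = (a', b', c', d')"
proof -
  have cancel: "x = y" if "t \<cdot>\<^sub>m x = t \<cdot>\<^sub>m y" "t \<noteq> 0" for x y :: "'a mat" and t
    using arg_cong[OF that(1), of "\<lambda>z. inverse t \<cdot>\<^sub>m z"] that(2)
    by (simp add: smult_inverse_smult)
  show ?thesis
    using eq assms(1-8) cancel[of \<epsilon> b b'] cancel[of "inverse \<epsilon>" c c']
    by (simp add: four_block_mat_inject[of _ n])
qed

lemma twist_surj:
  assumes A: "A \<in> carrier_mat (2 * n) (2 * n)"
  obtains a b c d where "a \<in> carrier_mat n n" "b \<in> carrier_mat n n"
    "c \<in> carrier_mat n n" "d \<in> carrier_mat n n" "A = twist (a, b, c, d)"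
proof -
  obtain a b c d where "split_block A n n = (a, b, c, d)" by (metis prod_cases4)
  note S = split_block[OF this, of n n]
  show ?thesis
  proof
    show "a \<in> carrier_mat n n" "inverse \<epsilon> \<cdot>\<^sub>m b \<in> carrier_mat n n"
      "\<epsilon> \<cdot>\<^sub>m c \<in> carrier_mat n n" "d \<in> carrier_mat n n" using S A by auto
    show "A = twist (a, inverse \<epsilon> \<cdot>\<^sub>m b, \<epsilon> \<cdot>\<^sub>m c, d)"
      using S(5) A by (simp add: smult_inverse_smult)
  qed
qed

lemma twist_mult:
  assumes "a \<in> carrier_mat n n" "b \<in> carrier_mat n n" "c \<in> carrier_mat n n" "d \<in> carrier_mat n n"
    and "a' \<in> carrier_mat n n" "b' \<in> carrier_mat n n" "c' \<in> carrier_mat n n" "d' \<in> carrier_mat n n"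
  shows "twist (a, b, c, d) * twist (a', b', c', d') =
    twist (a * a' + b * c', a * b' + b * d', c * a' + d * c', c * b' + d * d')"
proof -
  have "twist (a, b, c, d) * twist (a', b', c', d') = four_block_mat
     (a * a' + (\<epsilon> \<cdot>\<^sub>m b) * (inverse \<epsilon> \<cdot>\<^sub>m c')) (a * (\<epsilon> \<cdot>\<^sub>m b') + (\<epsilon> \<cdot>\<^sub>m b) * d')
     ((inverse \<epsilon> \<cdot>\<^sub>m c) * a' + d * (inverse \<epsilon> \<cdot>\<^sub>m c')) ((inverse \<epsilon> \<cdot>\<^sub>m c) * (\<epsilon> \<cdot>\<^sub>m b') + d * d')"
    unfolding twist.simps using assms by (intro mult_four_block_mat[of _ n n _ n _ n _ _ n _ n]) auto
  then show ?thesis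
    using assms
    by (simp add: mult_smult_distrib[of _ n n _ n] mult_smult_assoc_mat[of _ n n _ n] smult_inverse_smult
        add_smult_distrib_left_mat[of _ n n])
qed

lemma star_twist:
  assumes "a \<in> carrier_mat n n" "b \<in> carrier_mat n n" "c \<in> carrier_mat n n" "d \<in> carrier_mat n n"
  shows "star (twist (a, b, c, d)) =
    four_block_mat (star a) (- inverse \<epsilon> \<cdot>\<^sub>m star c) (- \<epsilon> \<cdot>\<^sub>m star b) (star d)"
  using assms by (simp add: star_four_block_mat[of _ n] star_smult hom_inverse)

lemma smult_diff_zero_iff:
  fixes X Y :: "'a mat"
  assumes "X \<in> carrier_mat n n" "Y \<in> carrier_mat n n" "t \<noteq> 0"
  shows "- t \<cdot>\<^sub>m X + t \<cdot>\<^sub>m Y = 0\<^sub>m n n \<longleftrightarrow> X = Y"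
    and "t \<cdot>\<^sub>m X + - t \<cdot>\<^sub>m Y = 0\<^sub>m n n \<longleftrightarrow> X = Y"
  using assms by (auto simp: mat_eq_iff)

text \<open>The dimensions are instantiated because the simplifier cannot guess the inner dimension
  in the carrier conditions of the general rules.\<close>

lemmas square_mat_simps =
  mult_smult_distrib[of _ n n _ n] mult_smult_assoc_mat[of _ n n _ n]
  mult_carrier_mat[of _ n n _ n] smult_carrier_mat[of _ n n] minus_carrier_mat[of _ n n]
  right_mult_one_mat[of _ n n] right_mult_zero_mat[of _ n n n]
  left_add_zero_mat[of _ n n] right_add_zero_mat[of _ n n] for n

lemma smult_inverse_cancel:
  fixes x y :: "'a mat"
  assumes "x \<in> carrier_mat n n" "y \<in> carrier_mat n n"
  shows "- inverse \<epsilon> \<cdot>\<^sub>m (\<epsilon> \<cdot>\<^sub>m x) + y = y - x"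
    and "y + - \<epsilon> \<cdot>\<^sub>m (inverse \<epsilon> \<cdot>\<^sub>m x) = y - x"
    and "\<epsilon> \<cdot>\<^sub>m (- inverse \<epsilon> \<cdot>\<^sub>m x) + y = y - x"
    and "y + inverse \<epsilon> \<cdot>\<^sub>m (- \<epsilon> \<cdot>\<^sub>m x) = y - x"
  using assms by (simp_all add: mat_eq_iff field_simps)

text \<open>The blocks of \<open>A\<^sup>* J A\<close> for \<open>A = twist (a, b, c, d)\<close>. The factor \<open>\<epsilon>\<close> enters \<open>A\<close>, and
  \<open>-\<epsilon>\<close> enters \<open>A\<^sup>*\<close>, which produces the minus signs; the two diagonal blocks are a nonzero
  multiple of a difference, and the lower left block is the adjoint of the upper right one.\<close>

lemma gram_twist_iff:
  assumes "a \<in> carrier_mat n n" "b \<in> carrier_mat n n" "c \<in> carrier_mat n n" "d \<in> carrier_mat n n"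
  shows "star (twist (a, b, c, d)) * J_plus n * twist (a, b, c, d) = J_plus n \<longleftrightarrow>
    star a * c = star c * a \<and> star b * d = star d * b \<and> star a * d - star c * b = 1\<^sub>m n"
    (is "?gram \<longleftrightarrow> ?conds")
proof -
  note carr = assms assms[THEN mat_star_carrier[of _ n n \<sigma>]]
  have SJ: "star (twist (a, b, c, d)) * J_plus n =
      four_block_mat (- inverse \<epsilon> \<cdot>\<^sub>m star c) (star a) (star d) (- \<epsilon> \<cdot>\<^sub>m star b)"
    unfolding star_twist[OF assms] J_plus_def
    by (subst mult_four_block_mat[of _ n n _ n _ n _ _ n _ n])
      (simp_all add: carr square_mat_simps[where n = n])
  have eq: "star (twist (a, b, c, d)) * J_plus n * twist (a, b, c, d) = four_block_mat
     (- inverse \<epsilon> \<cdot>\<^sub>m (star c * a) + inverse \<epsilon> \<cdot>\<^sub>m (star a * c)) (star a * d - star c * b)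
     (star d * a - star b * c) (\<epsilon> \<cdot>\<^sub>m (star d * b) + - \<epsilon> \<cdot>\<^sub>m (star b * d))"
    unfolding SJ unfolding twist.simps
    by (subst mult_four_block_mat[of _ n n _ n _ n _ _ n _ n])
      (simp_all add: carr square_mat_simps[where n = n] smult_inverse_cancel[where n = n])
  have "?gram \<longleftrightarrow> star c * a = star a * c \<and> star a * d - star c * b = 1\<^sub>m n \<and>
      star d * a - star b * c = 1\<^sub>m n \<and> star d * b = star b * d"
    unfolding eq unfolding J_plus_def
    by (subst four_block_mat_inject[of _ n]) (simp_all add: carr square_mat_simps[where n = n]
        smult_diff_zero_iff[of _ n])
  moreover have "star d * a - star b * c = star (star a * d - star c * b)"
    by (simp add: star_minus[of _ n n] star_mult[of _ n n _ n] carr square_mat_simps[where n = n])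
  ultimately show ?thesis by auto
qed

lemma cogram_twist_iff:
  assumes "a \<in> carrier_mat n n" "b \<in> carrier_mat n n" "c \<in> carrier_mat n n" "d \<in> carrier_mat n n"
  shows "twist (a, b, c, d) * J_plus n * star (twist (a, b, c, d)) = J_plus n \<longleftrightarrow>
    a * star b = b * star a \<and> c * star d = d * star c \<and> a * star d - b * star c = 1\<^sub>m n"
    (is "?cogram \<longleftrightarrow> ?conds")
proof -
  note carr = assms assms[THEN mat_star_carrier[of _ n n \<sigma>]]
  have AJ: "twist (a, b, c, d) * J_plus n =
      four_block_mat (\<epsilon> \<cdot>\<^sub>m b) a d (inverse \<epsilon> \<cdot>\<^sub>m c)"
    unfolding twist.simps J_plus_def
    by (subst mult_four_block_mat[of _ n n _ n _ n _ _ n _ n])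
      (simp_all add: carr square_mat_simps[where n = n])
  have eq: "twist (a, b, c, d) * J_plus n * star (twist (a, b, c, d)) = four_block_mat
     (\<epsilon> \<cdot>\<^sub>m (b * star a) + - \<epsilon> \<cdot>\<^sub>m (a * star b)) (a * star d - b * star c)
     (d * star a - c * star b) (- inverse \<epsilon> \<cdot>\<^sub>m (d * star c) + inverse \<epsilon> \<cdot>\<^sub>m (c * star d))"
    unfolding AJ star_twist[OF assms]
    by (subst mult_four_block_mat[of _ n n _ n _ n _ _ n _ n])
      (simp_all add: carr square_mat_simps[where n = n] smult_inverse_cancel[where n = n])
  have "?cogram \<longleftrightarrow> b * star a = a * star b \<and> a * star d - b * star c = 1\<^sub>m n \<and>
      d * star a - c * star b = 1\<^sub>m n \<and> d * star c = c * star d"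
    unfolding eq unfolding J_plus_def
    by (subst four_block_mat_inject[of _ n]) (simp_all add: carr square_mat_simps[where n = n]
        smult_diff_zero_iff[of _ n])
  moreover have "d * star a - c * star b = star (a * star d - b * star c)"
    by (simp add: star_minus[of _ n n] star_mult[of _ n n _ n] carr square_mat_simps[where n = n])
  ultimately show ?thesis by auto
qed

abbreviation SL :: "nat \<Rightarrow> ('a mat \<times> 'a mat \<times> 'a mat \<times> 'a mat) monoid" where
  "SL n \<equiv> SL_star_minus (ring_mat TYPE('a) n ()) star"

lemma ring_mat_minus:
  fixes A B :: "'a mat"
  assumes "A \<in> carrier_mat n n" "B \<in> carrier_mat n n"
  shows "A \<ominus>\<^bsub>ring_mat TYPE('a) n ()\<^esub> B = A - B"
proof -
  interpret R: ring "ring_mat TYPE('a) n ()" by (rule ring_mat)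
  have "\<ominus>\<^bsub>ring_mat TYPE('a) n ()\<^esub> B = - B"
    using assms by (intro R.minus_equality) (auto simp: ring_mat_simps)
  then show ?thesis
    using assms by (simp add: a_minus_def ring_mat_simps) (auto intro!: eq_matI)
qed

text \<open>Membership means both \<open>A\<^sup>* J A = J\<close> and \<open>A J A\<^sup>* = J\<close>; the second equation is a
  consequence of the first.\<close>

lemma mem_SL_iff_gram:
  assumes "a \<in> carrier_mat n n" "b \<in> carrier_mat n n" "c \<in> carrier_mat n n" "d \<in> carrier_mat n n"
  shows "(a, b, c, d) \<in> carrier (SL n) \<longleftrightarrow>
    star (twist (a, b, c, d)) * J_plus n * twist (a, b, c, d) = J_plus n"
proof -
  have "(a, b, c, d) \<in> carrier (SL n) \<longleftrightarrow>
      star (twist (a, b, c, d)) * J_plus n * twist (a, b, c, d) = J_plus n \<and>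
      twist (a, b, c, d) * J_plus n * star (twist (a, b, c, d)) = J_plus n"
    unfolding gram_twist_iff[OF assms] cogram_twist_iff[OF assms]
    using assms
    by (auto simp: SL_star_minus_def ring_mat_simps ring_mat_minus mult_carrier_mat[of _ n n])
  then show ?thesis
    using gram_inverse(3)[OF twist_carrier[OF assms(1,4)]] by blast
qed

section \<open>The isomorphism\<close>

definition twist_map :: "nat \<Rightarrow> 'a mat \<times> 'a mat \<times> 'a mat \<times> 'a mat \<Rightarrow> 'a vec \<Rightarrow> 'a vec" where
  "twist_map n t = (\<lambda>x\<in>carrier_vec (2 * n). twist t *\<^sub>v x)"

text \<open>Linearity is automatic. Bijectivity, which membership also requires, comes from the
  inverse \<open>J A\<^sup>* J\<close> once the Gram equation holds.\<close>

lemma mem_unitary_group_iff_gram: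
  assumes A: "A \<in> carrier_mat (2 * n) (2 * n)"
  shows "(\<lambda>x\<in>carrier_vec (2 * n). A *\<^sub>v x) \<in> carrier (unitary_group \<sigma> n) \<longleftrightarrow>
    star A * J_plus n * A = J_plus n" (is "?f \<in> _ \<longleftrightarrow> ?gram")
proof -
  let ?V = "carrier_vec (2 * n) :: 'a vec set"
  have AV: "A *\<^sub>v x \<in> ?V" if "x \<in> ?V" for x
    using A that by (rule mult_mat_vec_carrier)
  have hom: "?f \<in> module_hom class_ring (module_vec TYPE('a) (2 * n)) (module_vec TYPE('a) (2 * n))"
    using A AV
    by (auto simp: module_hom_def module_vec_simps mult_add_distrib_mat_vec[of _ "2 * n" "2 * n"]
        mult_mat_vec[of _ "2 * n" "2 * n"])
  have bij: "?f \<in> Bij ?V" if gram: ?gram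
  proof -
    let ?B = "J_plus n * star A * J_plus n"
    have B: "?B \<in> carrier_mat (2 * n) (2 * n)"
      using A by (intro mult_carrier_mat[of _ "2 * n" "2 * n"]) auto
    have "bij_betw ?f ?V ?V"
    proof (rule bij_betwI[of _ _ _ "\<lambda>x. ?B *\<^sub>v x"])
      show "?f \<in> ?V \<rightarrow> ?V" using AV by auto
      show "(\<lambda>x. ?B *\<^sub>v x) \<in> ?V \<rightarrow> ?V" using mult_mat_vec_carrier[OF B] by auto
      show "?B *\<^sub>v ?f x = x" if "x \<in> ?V" for x
        using that assoc_mult_mat_vec[OF B A that] gram_inverse(1)[OF A gram] by simp
      show "?f (?B *\<^sub>v y) = y" if "y \<in> ?V" for y
        using that assoc_mult_mat_vec[OF A B that] gram_inverse(2)[OF A gram]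
          mult_mat_vec_carrier[OF B that] by simp
    qed
    then show ?thesis by (simp add: Bij_def)
  qed
  have iso: "(\<forall>x\<in>?V. \<forall>y\<in>?V. herm_form \<sigma> n (?f x) (?f y) = herm_form \<sigma> n x y) \<longleftrightarrow> ?gram"
    using isometry_iff_mat[OF A] by simp
  show ?thesis
    using hom bij iso unfolding unitary_group_def by auto
qed

lemma twist_map_mem_unitary_iff:
  assumes "a \<in> carrier_mat n n" "b \<in> carrier_mat n n" "c \<in> carrier_mat n n" "d \<in> carrier_mat n n"
  shows "twist_map n (a, b, c, d) \<in> carrier (unitary_group \<sigma> n) \<longleftrightarrow>
    (a, b, c, d) \<in> carrier (SL n)"
  unfolding twist_map_def mem_SL_iff_gram[OF assms]
  by (rule mem_unitary_group_iff_gram[OF twist_carrier[OF assms(1,4)]])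

lemma SL_cases:
  assumes "t \<in> carrier (SL n)"
  obtains a b c d where "t = (a, b, c, d)" "a \<in> carrier_mat n n" "b \<in> carrier_mat n n"
    "c \<in> carrier_mat n n" "d \<in> carrier_mat n n"
  using assms by (auto simp: SL_star_minus_def ring_mat_simps)

text \<open>Closure of the matrix group under multiplication is inherited from the unitary group,
  since membership on either side is the same condition by \<open>twist_map_mem_unitary_iff\<close>.\<close>

lemma twist_map_mult:
  assumes s: "s \<in> carrier (SL n)" and t: "t \<in> carrier (SL n)"
  shows "s \<otimes>\<^bsub>SL n\<^esub> t \<in> carrier (SL n)"
    and "twist_map n (s \<otimes>\<^bsub>SL n\<^esub> t) = twist_map n s \<otimes>\<^bsub>unitary_group \<sigma> n\<^esub> twist_map n t"
proof -
  let ?U = "unitary_group \<sigma> n" and ?V = "carrier_vec (2 * n) :: 'a vec set"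
  interpret U: group ?U by (rule group_unitary_group)
  from s obtain a b c d where s_eq: "s = (a, b, c, d)"
    and m: "a \<in> carrier_mat n n" "b \<in> carrier_mat n n" "c \<in> carrier_mat n n" "d \<in> carrier_mat n n"
    by (rule SL_cases)
  from t obtain a' b' c' d' where t_eq: "t = (a', b', c', d')"
    and m': "a' \<in> carrier_mat n n" "b' \<in> carrier_mat n n" "c' \<in> carrier_mat n n" "d' \<in> carrier_mat n n"
    by (rule SL_cases)
  have st: "s \<otimes>\<^bsub>SL n\<^esub> t =
      (a * a' + b * c', a * b' + b * d', c * a' + d * c', c * b' + d * d')"
    by (simp add: s_eq t_eq SL_star_minus_def ring_mat_simps)
  have fs: "twist_map n s \<in> carrier ?U" and ft: "twist_map n t \<in> carrier ?U"
    using s t twist_map_mem_unitary_iff[OF m] twist_map_mem_unitary_iff[OF m']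
    by (simp_all add: s_eq t_eq)
  have A: "twist s \<in> carrier_mat (2 * n) (2 * n)" and B: "twist t \<in> carrier_mat (2 * n) (2 * n)"
    unfolding s_eq t_eq using m m' by (auto intro!: twist_carrier simp del: twist.simps)
  have "twist (s \<otimes>\<^bsub>SL n\<^esub> t) = twist s * twist t"
    unfolding st unfolding s_eq t_eq by (rule twist_mult[OF m m', symmetric])
  then have "twist_map n (s \<otimes>\<^bsub>SL n\<^esub> t) = compose ?V (twist_map n s) (twist_map n t)"
    unfolding twist_map_def compose_def using mult_mat_vec_carrier[OF B]
    by (intro restrict_ext) (simp add: assoc_mult_mat_vec[OF A B])
  also have "\<dots> = twist_map n s \<otimes>\<^bsub>?U\<^esub> twist_map n t"
    using fs ft by (simp add: unitary_group_def BijGroup_def)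
  finally show mult: "twist_map n (s \<otimes>\<^bsub>SL n\<^esub> t) = twist_map n s \<otimes>\<^bsub>?U\<^esub> twist_map n t" .
  have "twist_map n (s \<otimes>\<^bsub>SL n\<^esub> t) \<in> carrier ?U"
    unfolding mult using fs ft by (rule U.m_closed)
  then show "s \<otimes>\<^bsub>SL n\<^esub> t \<in> carrier (SL n)"
    unfolding st using m m' by (subst (asm) twist_map_mem_unitary_iff) auto
qed

lemma twist_map_bij:
  "bij_betw (twist_map n) (carrier (SL n)) (carrier (unitary_group \<sigma> n))"
proof (rule bij_betw_imageI)
  show "inj_on (twist_map n) (carrier (SL n))"
  proof (rule inj_onI)
    fix s t assume s: "s \<in> carrier (SL n)" and t: "t \<in> carrier (SL n)"
      and eq: "twist_map n s = twist_map n t"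
    from s obtain a b c d where s_eq: "s = (a, b, c, d)"
      and m: "a \<in> carrier_mat n n" "b \<in> carrier_mat n n" "c \<in> carrier_mat n n" "d \<in> carrier_mat n n"
      by (rule SL_cases)
    from t obtain a' b' c' d' where t_eq: "t = (a', b', c', d')"
      and m': "a' \<in> carrier_mat n n" "b' \<in> carrier_mat n n" "c' \<in> carrier_mat n n" "d' \<in> carrier_mat n n"
      by (rule SL_cases)
    have "twist s *\<^sub>v x = twist t *\<^sub>v x" if "x \<in> carrier_vec (2 * n)" for x
      using fun_cong[OF eq, of x] that by (simp add: twist_map_def)
    then have "twist s = twist t"
      unfolding s_eq t_eq
      by (intro mat_eq_by_action[OF twist_carrier[OF m(1,4)] twist_carrier[OF m'(1,4)]])
    then show "s = t"
      unfolding s_eq t_eq by (rule twist_inject[OF m m'])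
  qed
  show "twist_map n ` carrier (SL n) = carrier (unitary_group \<sigma> n)"
  proof
    show "twist_map n ` carrier (SL n) \<subseteq> carrier (unitary_group \<sigma> n)"
    proof
      fix f assume "f \<in> twist_map n ` carrier (SL n)"
      then obtain t where t: "t \<in> carrier (SL n)" "f = twist_map n t" by blast
      from t(1) obtain a b c d where "t = (a, b, c, d)" "a \<in> carrier_mat n n"
        "b \<in> carrier_mat n n" "c \<in> carrier_mat n n" "d \<in> carrier_mat n n"
        by (rule SL_cases)
      then show "f \<in> carrier (unitary_group \<sigma> n)"
        using t twist_map_mem_unitary_iff[of a n b c d] by simp
    qed
    show "carrier (unitary_group \<sigma> n) \<subseteq> twist_map n ` carrier (SL n)"
    proof
      fix f assume f: "f \<in> carrier (unitary_group \<sigma> n)"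
      let ?V = "carrier_vec (2 * n) :: 'a vec set"
      have ext: "f \<in> extensional ?V"
        and hom: "f \<in> module_hom class_ring (module_vec TYPE('a) (2 * n)) (module_vec TYPE('a) (2 * n))"
        using f by (auto simp: unitary_group_def Bij_def)
      from hom obtain A where A: "A \<in> carrier_mat (2 * n) (2 * n)"
        and fA: "\<And>x. x \<in> ?V \<Longrightarrow> f x = A *\<^sub>v x"
        using linear_map_eq_mult_mat_vec by blast
      from A obtain a b c d where
        m: "a \<in> carrier_mat n n" "b \<in> carrier_mat n n" "c \<in> carrier_mat n n" "d \<in> carrier_mat n n"
        and A_eq: "A = twist (a, b, c, d)"
        by (rule twist_surj)
      have "f = twist_map n (a, b, c, d)"
        using ext fA by (intro extensionalityI[of _ ?V]) (auto simp: twist_map_def A_eq)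
      moreover from this f have "(a, b, c, d) \<in> carrier (SL n)"
        using twist_map_mem_unitary_iff[OF m] by simp
      ultimately show "f \<in> twist_map n ` carrier (SL n)" by blast
    qed
  qed
qed

text \<open>The multiplicative bijection \<^const>\<open>twist_map\<close> runs from the matrix group to the
  unitary group; its inverse is the isomorphism in the stated direction.\<close>

lemma unitary_group_iso_SL: "unitary_group \<sigma> n \<cong> SL n"
proof (rule is_isoI, rule isoI)
  let ?g = "inv_into (carrier (SL n)) (twist_map n)"
  note bij = twist_map_bij[of n]
  show bij': "bij_betw ?g (carrier (unitary_group \<sigma> n)) (carrier (SL n))"
    using bij by (rule bij_betw_inv_into)
  show "?g \<in> hom (unitary_group \<sigma> n) (SL n)"
  proof (rule homI)
    fix x y assume x: "x \<in> carrier (unitary_group \<sigma> n)" and y: "y \<in> carrier (unitary_group \<sigma> n)"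
    show gx: "?g x \<in> carrier (SL n)" using bij' x by (rule bij_betw_apply)
    have gy: "?g y \<in> carrier (SL n)" using bij' y by (rule bij_betw_apply)
    have "x \<otimes>\<^bsub>unitary_group \<sigma> n\<^esub> y = twist_map n (?g x \<otimes>\<^bsub>SL n\<^esub> ?g y)"
      using twist_map_mult(2)[OF gx gy] bij_betw_inv_into_right[OF bij] x y by simp
    then show "?g (x \<otimes>\<^bsub>unitary_group \<sigma> n\<^esub> y) = ?g x \<otimes>\<^bsub>SL n\<^esub> ?g y"
      using bij_betw_inv_into_left[OF bij twist_map_mult(1)[OF gx gy]] by simp
  qed
qed

end

theorem theorem3p1:
  fixes q n :: nat and k :: "'a::field set" and \<sigma> :: "'a \<Rightarrow> 'a"
  assumes "primepow q" and "odd q" and "n \<ge> 1"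
    and "card (UNIV :: 'a set) = q\<^sup>2"
    and "subfield k (class_ring :: 'a ring)" and "card k = q"
    and "nontrivial_automorphism_over k \<sigma>"
  shows "unitary_group \<sigma> n \<cong> SL_star_minus (ring_mat TYPE('a) n ()) (mat_star \<sigma>)"
proof -
  have "q > 0" using \<open>odd q\<close> by (rule odd_pos)
  then have fin: "finite (UNIV :: 'a set)"
    using assms(4) by (intro card_ge_0_finite) simp
  have card: "card (UNIV :: 'a set) = (card k)\<^sup>2" using assms(4,6) by simp
  note conj = quadratic_conjugation[OF card fin assms(5,7)]
  obtain \<epsilon> where "\<epsilon> \<noteq> 0" "\<sigma> \<epsilon> = - \<epsilon>" using conj(2) by blast
  then interpret skew_conjugation \<sigma> \<epsilon>
    using conj(1) nontrivial_automorphism_field_hom[OF assms(7)]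
    by (simp add: skew_conjugation_def skew_conjugation_axioms_def)
  show ?thesis by (rule unitary_group_iso_SL)
qed

end
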